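(* Let $N\ge 1$ be an integer, $[N]=\{1,\ldots,N\}$, and let $\Phi([N])$ be the set of all fuzzy subsets of $[N]$. Then the function $\mathrm{dist}:\Phi([N])\times\Phi([N])\to\mathbb{R}$, $\mathrm{dist}(A,B)=\frac1N\sum_{x=1}^N H(X_{A\vartriangle B}(x))$, is a semi-metric on $\Phi([N])$, i.e., for all $A,B,C\in\Phi([N])$: (i) $\mathrm{dist}(A,B)\ge 0$; (ii) $\mathrm{dist}(A,B)=\mathrm{dist}(B,A)$; (iii) $\mathrm{dist}(A,B)=0$ if $A=B$; (iv) $\mathrm{dist}(A,C)\le \mathrm{dist}(A,B)+\mathrm{dist}(B,C)$.
   Context: A fuzzy subset $A$ of $[N]=\{1,\ldots,N\}$ is given by its membership function $m_A:[N]\to[0,1]$ (an arbitrary function); $\Phi([N])$ denotes the set of all fuzzy subsets of $[N]$. For $A,B\in\Phi([N])$ and $x\in[N]$ define $m_{A\cup B}(x)=\max\{m_A(x),m_B(x)\}$, $m_{A\cap B}(x)=\min\{m_A(x),m_B(x)\}$, and $m_{A\vartriangle B}(x)=m_{A\cup B}(x)-m_{A\cap B}(x)$. $X_{A\vartriangle B}(x)$ denotes a Bernoulli random variable taking the value $1$ with probability $m_{A\vartriangle B}(x)$ and the value $0$ with probability $1-m_{A\vartriangle B}(x)$. $H(X)$ denotes the entropy in bits: if $X$ is Bernoulli with success probability $p\in[0,1]$, then $H(X)=-p\log p-(1-p)\log(1-p)$, with $\log$ to base $2$ and the convention $0\log 0=0$. Thus $H(X_{A\vartriangle B}(x))=-p\log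 p-(1-p)\log(1-p)$ with $p=m_{A\vartriangle B}(x)$. Here "semi-metric" means exactly properties (i)–(iv) of the claim; $\mathrm{dist}(A,B)=0$ is not required to imply $A=B$. *)

theory Defs
  imports "HOL-Probability.Probability"
begin

text \<open>
  A fuzzy subset of \<open>{1..N}\<close> is identified with its membership function. Membership functions
  are taken to be extensional (undefined off \<open>{1..N}\<close>), so that equality of fuzzy subsets is
  equality of HOL functions.
\<close>

definition fuzzy_subsets :: "nat \<Rightarrow> (nat \<Rightarrow> real) set" where
  "fuzzy_subsets N = {1..N} \<rightarrow>\<^sub>E {0..1}"

definition fuzzy_union :: "nat \<Rightarrow> (nat \<Rightarrow> real) \<Rightarrow> (nat \<Rightarrow> real) \<Rightarrow> (nat \<Rightarrow> real)" where
  "fuzzy_union N A B = (\<lambda>x\<in>{1..N}. max (A x) (B x))"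

definition fuzzy_inter :: "nat \<Rightarrow> (nat \<Rightarrow> real) \<Rightarrow> (nat \<Rightarrow> real) \<Rightarrow> (nat \<Rightarrow> real)" where
  "fuzzy_inter N A B = (\<lambda>x\<in>{1..N}. min (A x) (B x))"

definition fuzzy_symdiff :: "nat \<Rightarrow> (nat \<Rightarrow> real) \<Rightarrow> (nat \<Rightarrow> real) \<Rightarrow> (nat \<Rightarrow> real)" where
  "fuzzy_symdiff N A B = (\<lambda>x\<in>{1..N}. fuzzy_union N A B x - fuzzy_inter N A B x)"

lemma fuzzy_symdiff_closed:
  assumes "A \<in> fuzzy_subsets N" "B \<in> fuzzy_subsets N"
  shows "fuzzy_symdiff N A B \<in> fuzzy_subsets N"
proof -
  have "fuzzy_symdiff N A B x \<in> {0..1}" if "x \<in> {1..N}" for x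
  proof -
    have "A x \<in> {0..1}" "B x \<in> {0..1}"
      using assms that by (auto simp: fuzzy_subsets_def PiE_iff)
    then show ?thesis
      using that by (auto simp: fuzzy_symdiff_def fuzzy_union_def fuzzy_inter_def max_def min_def)
  qed
  then show ?thesis
    by (auto simp: fuzzy_subsets_def fuzzy_symdiff_def)
qed

text \<open>
  The entropy in bits of a random variable \<open>X\<close> with values 0 and 1 such that
  \<open>X = 1\<close> has probability \<open>p\<close>, realised on the two-point space of \<^const>\<open>bernoulli_pmf\<close>.
  The parameter is meaningful for \<open>0 \<le> p \<le> 1\<close> only: \<^const>\<open>bernoulli_pmf\<close> clamps other values.
\<close>

definition bernoulli_entropy :: "real \<Rightarrow> real" where
  "bernoulli_entropy p =
     prob_space.entropy (measure_pmf (bernoulli_pmf p)) 2 (count_space {0, 1}) (of_bool :: bool \<Rightarrow> nat)"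

text \<open>The convention \<open>0 log 0 = 0\<close> is automatic, as \<^const>\<open>log\<close> is total.\<close>

lemma bernoulli_entropy_eq:
  assumes "0 \<le> p" "p \<le> 1"
  shows "bernoulli_entropy p = - p * log 2 p - (1 - p) * log 2 (1 - p)"
proof -
  let ?M = "measure_pmf (bernoulli_pmf p)"
  let ?X = "of_bool :: bool \<Rightarrow> nat"
  let ?f = "\<lambda>k::nat. if k = 1 then p else 1 - p"
  interpret information_space ?M 2
    by unfold_locales auto
  have ran: "?X ` space ?M = {0, 1}"
    by (auto simp: UNIV_bool)
  have "simple_distributed ?M ?X ?f"
  proof (rule measure_pmf.simple_distributedI)
    show "simple_function ?M ?X"
      by (auto simp: simple_function_def)
    show "?f x = measure ?M (?X -` {x} \<inter> space ?M)" if "x \<in> ?X ` space ?M" for x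
    proof -
      have "?X -` {1} = {True}" "?X -` {0} = {False}"
        by (auto simp: of_bool_def split: if_splits)
      moreover have "x = 0 \<or> x = 1"
        using that unfolding ran by simp
      ultimately show ?thesis
        using assms by (elim disjE) (simp_all add: measure_pmf_single)
    qed
  qed (use assms in auto)
  from entropy_simple_distributed[OF this] show ?thesis
    unfolding ran bernoulli_entropy_def by simp
qed

definition fuzzy_dist :: "nat \<Rightarrow> (nat \<Rightarrow> real) \<Rightarrow> (nat \<Rightarrow> real) \<Rightarrow> real" where
  "fuzzy_dist N A B = 1 / real N * (\<Sum>x=1..N. bernoulli_entropy (fuzzy_symdiff N A B x))"

text \<open>Distinct points may be at distance zero.\<close>

definition semi_metric_on :: "'a set \<Rightarrow> ('a \<Rightarrow> 'a \<Rightarrow> real) \<Rightarrow> bool" where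
  "semi_metric_on S d \<longleftrightarrow>
     (\<forall>A\<in>S. \<forall>B\<in>S. \<forall>C\<in>S.
        d A B \<ge> 0 \<and>
        d A B = d B A \<and>
        (A = B \<longrightarrow> d A B = 0) \<and>
        d A C \<le> d A B + d B C)"

end

theory Submission
  imports Defs
begin

text \<open>
  The binary entropy function \<open>h\<close> is concave on \<open>[0, 1]\<close> with \<open>h 0 = 0\<close>, hence subadditive for
  arguments with sum at most 1, and \<open>h (1 - p) = h p\<close>. At each point put \<open>p = \<bar>a - b\<bar>\<close> and
  \<open>q = \<bar>b - c\<bar>\<close>. Then \<open>\<bar>a - c\<bar>\<close> is either \<open>p + q\<close>, where subadditivity applies directly, or (up
  to exchanging \<open>p\<close> and \<open>q\<close>) \<open>p - q\<close>, where \<open>h (p - q) = h ((1 - p) + q) \<le> h (1 - p) + h q\<close>.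
\<close>

lemma bernoulli_entropy_0 [simp]: "bernoulli_entropy 0 = 0"
  by (simp add: bernoulli_entropy_eq)

lemma bernoulli_entropy_compl:
  assumes "0 \<le> p" "p \<le> 1"
  shows "bernoulli_entropy (1 - p) = bernoulli_entropy p"
  using assms by (simp add: bernoulli_entropy_eq algebra_simps)

lemma bernoulli_entropy_nonneg:
  assumes "0 \<le> p" "p \<le> 1"
  shows "0 \<le> bernoulli_entropy p"
proof -
  have "x * log 2 x \<le> 0" if "0 \<le> x" "x \<le> 1" for x :: real
    using that by (cases "x = 0") (auto simp: mult_le_0_iff)
  from this[of p] this[of "1 - p"] show ?thesis
    using assms by (simp add: bernoulli_entropy_eq)
qed

text \<open>One term of Gibbs' inequality: \<open>ln t \<le> t - 1\<close> at
  \<open>t = r / s\<close>, scaled by \<open>s\<close>.\<close>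

lemma mult_log_le_mult_log:
  fixes b r s :: real
  assumes "1 < b" "0 < r" "0 \<le> s"
  shows "s * log b r \<le> s * log b s + (r - s) / ln b"
proof (cases "s = 0")
  case True
  then show ?thesis using assms by simp
next
  case False
  with assms have "s > 0" by simp
  have "s * (ln r - ln s) \<le> s * (r / s - 1)"
    using ln_le_minus_one[of "r / s"] \<open>s > 0\<close> \<open>r > 0\<close>
    by (intro mult_left_mono) (auto simp: ln_div)
  also have "\<dots> = r - s"
    using \<open>s > 0\<close> by (simp add: field_simps)
  finally have "s * (ln r - ln s) / ln b \<le> (r - s) / ln b"
    using assms by (intro divide_right_mono) auto
  then show ?thesis
    by (simp add: log_def algebra_simps diff_divide_distrib)
qed

text \<open>Gibbs' inequality on two points: the remainders \<open>(r - s) / ln 2\<close> and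
  \<open>(s - r) / ln 2\<close> cancel.\<close>

lemma bernoulli_entropy_le_cross_entropy:
  assumes "0 < r" "r < 1" "0 \<le> s" "s \<le> 1"
  shows "bernoulli_entropy s \<le> - s * log 2 r - (1 - s) * log 2 (1 - r)"
  using mult_log_le_mult_log[of 2 r s] mult_log_le_mult_log[of 2 "1 - r" "1 - s"] assms
  by (simp add: bernoulli_entropy_eq diff_divide_distrib)

text \<open>
  The cross entropy is affine in \<open>s\<close> and nonnegative at \<open>s = 0\<close>, so its value at \<open>p\<close> relative to
  \<open>p\<close> itself is at least \<open>p / s\<close> times its value at \<open>s\<close>.
\<close>
lemma bernoulli_entropy_chord:
  assumes "0 \<le> p" "p \<le> s" "s \<le> 1"
  shows "p * bernoulli_entropy s \<le> s * bernoulli_entropy p"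
\<comment> \<open>The cross entropy bound needs \<open>0 < p < 1\<close>; \<open>p = 1\<close>
  forces \<open>s = 1\<close>.\<close>
proof (cases "p = 0 \<or> p = 1")
  case True
  then show ?thesis using assms by auto
next
  case False
  with assms have p: "0 < p" "p < 1" by auto
  have "p * bernoulli_entropy s \<le> p * (- s * log 2 p - (1 - s) * log 2 (1 - p))"
    using bernoulli_entropy_le_cross_entropy[of p s] p assms by (intro mult_left_mono) auto
  also have "\<dots> = s * bernoulli_entropy p + (s - p) * log 2 (1 - p)"
    using p by (simp add: bernoulli_entropy_eq algebra_simps)
  also have "\<dots> \<le> s * bernoulli_entropy p"
    using p assms by (simp add: mult_le_0_iff)
  finally show ?thesis .
qed

lemma bernoulli_entropy_subadd:
  assumes "0 \<le> p" "0 \<le> q" "p + q \<le> 1"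
  shows "bernoulli_entropy (p + q) \<le> bernoulli_entropy p + bernoulli_entropy q"
proof (cases "p + q = 0")
  case True
  with assms have "p = 0" "q = 0" by auto
  then show ?thesis by simp
next
  case False
  \<comment> \<open>Add the chord bounds for \<open>p\<close> and \<open>q\<close>, both with
    \<open>s = p + q\<close>.\<close>
  have "(p + q) * bernoulli_entropy (p + q) \<le> (p + q) * (bernoulli_entropy p + bernoulli_entropy q)"
    using bernoulli_entropy_chord[of p "p + q"] bernoulli_entropy_chord[of q "p + q"] assms
    by (simp add: distrib_left distrib_right)
  then show ?thesis
    using False assms by (simp add: mult_le_cancel_left)
qed

lemma bernoulli_entropy_diff_le:
  assumes "0 \<le> q" "q \<le> p" "p \<le> 1"
  shows "bernoulli_entropy (p - q) \<le> bernoulli_entropy p + bernoulli_entropy q"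
  using bernoulli_entropy_subadd[of "1 - p" q] bernoulli_entropy_compl[of p]
    bernoulli_entropy_compl[of "p - q"] assms
  by (simp add: algebra_simps)

lemma bernoulli_entropy_abs_triangle:
  assumes "a \<in> {0..1}" "b \<in> {0..1}" "c \<in> {0..1}"
  shows "bernoulli_entropy \<bar>a - c\<bar> \<le> bernoulli_entropy \<bar>a - b\<bar> + bernoulli_entropy \<bar>b - c\<bar>"
proof -
  let ?p = "\<bar>a - b\<bar>" and ?q = "\<bar>b - c\<bar>"
  have bounds: "?p \<le> 1" "?q \<le> 1" "\<bar>a - c\<bar> \<le> 1"
    using assms by auto
  \<comment> \<open>The cases correspond to \<open>b\<close>, \<open>c\<close> or \<open>a\<close>
    lying between the other two.\<close>
  consider "\<bar>a - c\<bar> = ?p + ?q" | "\<bar>a - c\<bar> = ?p - ?q" | "\<bar>a - c\<bar> = ?q - ?p"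
    by linarith
  then show ?thesis
  proof cases
    case 1
    then show ?thesis using bernoulli_entropy_subadd[of ?p ?q] bounds by simp
  next
    case 2
    then have "?q \<le> ?p" by linarith
    then show ?thesis using bernoulli_entropy_diff_le[of ?q ?p] bounds 2 by simp
  next
    case 3
    then have "?p \<le> ?q" by linarith
    then show ?thesis using bernoulli_entropy_diff_le[of ?p ?q] bounds 3 by simp
  qed
qed

text \<open>Maximum minus minimum is the absolute difference, so each semi-metric property reduces
  to a pointwise fact about reals.\<close>

lemma fuzzy_dist_altdef:
  "fuzzy_dist N A B = (\<Sum>x=1..N. bernoulli_entropy \<bar>A x - B x\<bar>) / real N"
proof -
  have "fuzzy_symdiff N A B x = \<bar>A x - B x\<bar>" if "x \<in> {1..N}" for x
    using that by (auto simp: fuzzy_symdiff_def fuzzy_union_def fuzzy_inter_def)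
  then show ?thesis
    by (simp add: fuzzy_dist_def)
qed

theorem theorem2:
  fixes N :: nat
  assumes "N \<ge> 1"
  shows "semi_metric_on (fuzzy_subsets N) (fuzzy_dist N)"
  unfolding semi_metric_on_def
proof (intro ballI conjI impI)
  fix A B C
  assume "A \<in> fuzzy_subsets N" "B \<in> fuzzy_subsets N" "C \<in> fuzzy_subsets N"
  then have in01: "A x \<in> {0..1}" "B x \<in> {0..1}" "C x \<in> {0..1}" if "x \<in> {1..N}" for x
    using that by (auto simp: fuzzy_subsets_def PiE_iff)
  have "\<bar>A x - B x\<bar> \<le> 1" if "x \<in> {1..N}" for x
    using in01[OF that] by auto
  then show "fuzzy_dist N A B \<ge> 0"
    unfolding fuzzy_dist_altdef
    by (intro divide_nonneg_nonneg sum_nonneg bernoulli_entropy_nonneg) auto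
  show "fuzzy_dist N A B = fuzzy_dist N B A"
    by (simp add: fuzzy_dist_altdef abs_minus_commute)
  show "fuzzy_dist N A B = 0" if "A = B"
    using that by (simp add: fuzzy_dist_altdef)
  show "fuzzy_dist N A C \<le> fuzzy_dist N A B + fuzzy_dist N B C"
    unfolding fuzzy_dist_altdef add_divide_distrib[symmetric] sum.distrib[symmetric]
    by (intro divide_right_mono sum_mono bernoulli_entropy_abs_triangle in01) auto
qed

end
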